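(* Let $G$ be a subgroup of $\mathrm{Homeo}^+(\mathbf{R})$. Suppose that there is a bounded interval $[c,d]\subset\mathbf{R}$ such that $\mathrm{Fix}(g)\subseteq [c,d]$ for every nontrivial $g\in G$. Then $G$ is abelian.
   Context: $\mathrm{Homeo}^+(\mathbf{R})$ denotes the group of orientation-preserving homeomorphisms of the real line $\mathbf{R}$ under composition. $\mathrm{Fix}(g)=\{x\in\mathbf{R} : g(x)=x\}$ (possibly empty). *)

theory Defs
  imports "HOL-Analysis.Analysis" "HOL-Algebra.Group"
begin

text \<open>A homeomorphism of the real line preserves orientation iff it is increasing; this is taken
  as the definition.\<close>

definition Homeo_plus :: "(real \<Rightarrow> real) monoid" where
  "Homeo_plus =
    \<lparr>carrier = {f. (\<exists>f'. homeomorphism UNIV UNIV f f') \<and> strict_mono f},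
     mult = (\<circ>), one = id\<rparr>"

definition Fix :: "(real \<Rightarrow> real) \<Rightarrow> real set" where
  "Fix g = {x. g x = x}"

lemma group_Homeo_plus: "group Homeo_plus"
proof (rule groupI)
  fix f g assume "f \<in> carrier Homeo_plus" "g \<in> carrier Homeo_plus"
  then show "f \<otimes>\<^bsub>Homeo_plus\<^esub> g \<in> carrier Homeo_plus"
    unfolding Homeo_plus_def by (auto simp: strict_mono_def dest: homeomorphism_compose)
next
  show "\<one>\<^bsub>Homeo_plus\<^esub> \<in> carrier Homeo_plus"
    unfolding Homeo_plus_def
    by (auto simp: strict_mono_def id_def intro!: exI[of _ "\<lambda>x. x"] homeomorphismI)
next
  fix f assume "f \<in> carrier Homeo_plus"
  then obtain f' where f': "homeomorphism UNIV UNIV f f'" and mono: "strict_mono f"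
    unfolding Homeo_plus_def by auto
  have eqs: "f (f' x) = x" "f' (f x) = x" for x
    using f' by (auto simp: homeomorphism_def)
  have "strict_mono f'"
    unfolding strict_mono_def using strict_mono_less[OF mono] eqs(1) by metis
  then have "f' \<in> carrier Homeo_plus"
    using homeomorphism_sym[THEN iffD1, OF f'] unfolding Homeo_plus_def by auto
  moreover have "f' \<otimes>\<^bsub>Homeo_plus\<^esub> f = \<one>\<^bsub>Homeo_plus\<^esub>"
    unfolding Homeo_plus_def by (auto simp: eqs)
  ultimately show "\<exists>g\<in>carrier Homeo_plus. g \<otimes>\<^bsub>Homeo_plus\<^esub> f = \<one>\<^bsub>Homeo_plus\<^esub>"
    by blast
qed (auto simp: Homeo_plus_def)

end

theory Submission
  imports Defs
begin

text \<open>
  Only the behaviour near \<open>+\<infinity>\<close> matters. Let all fixed points of nontrivial elements of \<open>G\<close> lie to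
  the left of \<open>d\<close> or at \<open>d\<close>. If \<open>f, g \<in> G\<close> agree at one point \<open>x > d\<close>, then \<open>g\<inverse> \<circ> f\<close> fixes \<open>x\<close>,
  so \<open>f = g\<close>; hence the graphs of two different elements do not cross over \<open>(d, \<infinity>)\<close>, and comparing
  values there is a total order on \<open>G\<close>. Left translations respect it because elements of \<open>G\<close> are
  increasing, right translations because an element of \<open>G\<close> maps large numbers to large numbers.
  The order is Archimedean: if \<open>f\<close> moves every point of \<open>(d, \<infinity>)\<close> to the right, then the orbit
  \<open>f\<^sup>n x\<close> of some \<open>x > d\<close> is increasing, and a finite limit would be a fixed point of \<open>f\<close> beyond \<open>d\<close>.
  So \<open>f\<^sup>n x\<close> eventually exceeds \<open>g x\<close>, and one point decides the comparison with \<open>g\<close>.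

  Hoelder's theorem, that a group with a bi-invariant Archimedean total order is abelian, finishes
  the proof. Every positive element lies between consecutive powers of any given positive \<open>\<epsilon>\<close>, so
  the commutator \<open>c\<close> of two positive elements lies strictly below \<open>\<epsilon>\<^sup>2\<close>. Suppose that \<open>c\<close> is
  positive. If some positive element is smaller than \<open>c\<close>, then there is a positive \<open>\<epsilon>\<close> with \<open>\<epsilon>\<^sup>2\<close> at
  most \<open>c\<close>, a contradiction. Otherwise \<open>c\<close> is the least positive element, of which all positive
  elements are powers, so they commute.
\<close>

section \<open>Hoelder's theorem on Archimedean ordered groups\<close>

locale archimedean_ordered_group = group G for G (structure) +
  fixes less :: "'a \<Rightarrow> 'a \<Rightarrow> bool" (infix "\<lless>" 50)
  assumes irrefl: "x \<in> carrier G \<Longrightarrow> \<not> x \<lless> x"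
    and trans: "\<lbrakk>x \<lless> y; y \<lless> z; x \<in> carrier G; y \<in> carrier G; z \<in> carrier G\<rbrakk> \<Longrightarrow> x \<lless> z"
    and total: "\<lbrakk>x \<in> carrier G; y \<in> carrier G; x \<noteq> y\<rbrakk> \<Longrightarrow> x \<lless> y \<or> y \<lless> x"
    and mult_left_mono:
      "\<lbrakk>x \<lless> y; x \<in> carrier G; y \<in> carrier G; z \<in> carrier G\<rbrakk> \<Longrightarrow> z \<otimes> x \<lless> z \<otimes> y"
    and mult_right_mono:
      "\<lbrakk>x \<lless> y; x \<in> carrier G; y \<in> carrier G; z \<in> carrier G\<rbrakk> \<Longrightarrow> x \<otimes> z \<lless> y \<otimes> z"
    and archimedean:
      "\<lbrakk>\<one> \<lless> x; x \<in> carrier G; y \<in> carrier G\<rbrakk> \<Longrightarrow> \<exists>n::nat. y \<lless> x [^] n"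
begin

lemma mult_strict_mono:
  assumes "x \<lless> y" "z \<lless> w"
    and "x \<in> carrier G" "y \<in> carrier G" "z \<in> carrier G" "w \<in> carrier G"
  shows "x \<otimes> z \<lless> y \<otimes> w"
  using trans[OF mult_right_mono[of x y z] mult_left_mono[of z w y]] assms by simp

lemma less_mult_left_cancel:
  assumes "z \<otimes> x \<lless> z \<otimes> y" "x \<in> carrier G" "y \<in> carrier G" "z \<in> carrier G"
  shows "x \<lless> y"
  using mult_left_mono[OF assms(1), of "inv z"] assms by (simp add: m_assoc[symmetric])

lemma less_mult_right_cancel:
  assumes "x \<otimes> z \<lless> y \<otimes> z" "x \<in> carrier G" "y \<in> carrier G" "z \<in> carrier G"
  shows "x \<lless> y"
  using mult_right_mono[OF assms(1), of "inv z"] assms by (simp add: m_assoc)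

lemma between_consecutive_powers:
  assumes "\<one> \<lless> e" "e \<in> carrier G" "\<one> \<lless> a" "a \<in> carrier G"
  obtains m :: nat where "e [^] m \<lless> a \<or> e [^] m = a" "a \<lless> e [^] m \<otimes> e"
proof -
  define k where "k = (LEAST n::nat. a \<lless> e [^] n)"
  have k: "a \<lless> e [^] k"
    unfolding k_def using archimedean[of e a] assms by (auto intro: LeastI_ex)
  have "k \<noteq> 0"
  proof
    assume "k = 0"
    then have "a \<lless> \<one>" using k by simp
    then show False using trans[of a \<one> a] irrefl assms by auto
  qed
  then obtain m where m: "k = Suc m" using not0_implies_Suc by auto
  have "\<not> a \<lless> e [^] m"
    using not_less_Least[of m "\<lambda>n. a \<lless> e [^] n"] m k_def by auto
  then have "e [^] m \<lless> a \<or> e [^] m = a"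
    using total[of a "e [^] m"] assms by auto
  then show thesis using that[of m] k m by simp
qed

lemma power_of_least_positive:
  assumes e: "\<one> \<lless> e" "e \<in> carrier G"
    and least: "\<And>x. \<lbrakk>\<one> \<lless> x; x \<in> carrier G\<rbrakk> \<Longrightarrow> \<not> x \<lless> e"
    and a: "\<one> \<lless> a" "a \<in> carrier G"
  obtains m :: nat where "a = e [^] m"
proof -
  obtain m :: nat where m: "e [^] m \<lless> a \<or> e [^] m = a" "a \<lless> e [^] m \<otimes> e"
    using between_consecutive_powers[OF e a] .
  define r where "r = inv (e [^] m) \<otimes> a"
  have r: "r \<in> carrier G" and ar: "a = e [^] m \<otimes> r"
    unfolding r_def using a e by (auto simp: m_assoc[symmetric])
  have "\<not> e [^] m \<lless> a"
  proof
    assume "e [^] m \<lless> a"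
    then have "\<one> \<lless> r"
      using less_mult_left_cancel[of "e [^] m" \<one> r] ar r e by simp
    moreover have "r \<lless> e"
      using less_mult_left_cancel[of "e [^] m" r e] m(2) ar r e by simp
    ultimately show False using least r by blast
  qed
  then show thesis using m that by auto
qed

text \<open>For \<open>1 \<lless> x \<lless> c\<close>, the product of \<open>x\<close> and its complement \<open>c \<otimes> inv x\<close> is \<open>c\<close>, so the smaller of the
  two has a square of at most \<open>c\<close>.\<close>

lemma small_square:
  assumes x: "\<one> \<lless> x" "x \<lless> c" "x \<in> carrier G" and c: "c \<in> carrier G"
  obtains e where "\<one> \<lless> e" "e \<in> carrier G" "\<not> c \<lless> e \<otimes> e"
proof (cases "c \<lless> x \<otimes> x")
  case False
  then show thesis using that x by blast
next
  case True
  define y where "y = c \<otimes> inv x"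
  have y: "y \<in> carrier G" and cy: "c = y \<otimes> x"
    unfolding y_def using x c by (auto simp: m_assoc)
  have "\<one> \<lless> y"
    using less_mult_right_cancel[of \<one> x y] x(2,3) y cy by simp
  moreover have "y \<lless> x"
    using less_mult_right_cancel[of y x x] True x(3) y cy by simp
  then have "y \<otimes> y \<lless> c"
    using mult_left_mono[of y x y] x(3) y cy by simp
  then have "\<not> c \<lless> y \<otimes> y"
    using trans[of c "y \<otimes> y" c] irrefl y c by auto
  ultimately show thesis using that y by blast
qed

text \<open>Let \<open>c\<close> be the commutator, so that \<open>c \<otimes> (b \<otimes> a) = a \<otimes> b\<close>. If \<open>a\<close> and \<open>b\<close> lie between the
  powers of \<open>\<epsilon>\<close> with exponents \<open>m, m + 1\<close> and \<open>n, n + 1\<close>, then \<open>b \<otimes> a\<close> is at least the power with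
  exponent \<open>m + n\<close>, while \<open>a \<otimes> b\<close> is less than the one with exponent \<open>m + n + 2\<close>. So \<open>c \<lless> \<epsilon>\<^sup>2\<close>, which
  is absurd for \<open>\<epsilon>\<close> as in \<open>small_square\<close>. If that lemma does not apply, then \<open>c\<close> is the least
  positive element, and \<open>a\<close> and \<open>b\<close> are powers of it.\<close>

lemma positive_commutator_not_positive:
  assumes a: "\<one> \<lless> a" "a \<in> carrier G" and b: "\<one> \<lless> b" "b \<in> carrier G"
  shows "\<not> b \<otimes> a \<lless> a \<otimes> b"
proof
  assume less: "b \<otimes> a \<lless> a \<otimes> b"
  define c where "c = a \<otimes> b \<otimes> inv (b \<otimes> a)"
  have c: "c \<in> carrier G" and cba: "c \<otimes> (b \<otimes> a) = a \<otimes> b"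
    unfolding c_def using a b by (auto simp: m_assoc simp del: inv_mult_group)
  have c_pos: "\<one> \<lless> c"
    using less_mult_right_cancel[of \<one> "b \<otimes> a" c] less cba a b c by simp
  show False
  proof (cases "\<exists>x\<in>carrier G. \<one> \<lless> x \<and> x \<lless> c")
    case False
    then have least: "\<not> x \<lless> c" if "\<one> \<lless> x" "x \<in> carrier G" for x using that by blast
    obtain m n :: nat where mn: "a = c [^] m" "b = c [^] n"
      using power_of_least_positive[OF c_pos c least a]
        power_of_least_positive[OF c_pos c least b] by metis
    have "a \<otimes> b = b \<otimes> a"
      unfolding mn using c by (simp add: nat_pow_mult add.commute)
    then show False using less irrefl a b by auto
  next
    case True
    then obtain e where e: "\<one> \<lless> e" "e \<in> carrier G" and ec: "\<not> c \<lless> e \<otimes> e"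
      using small_square c by metis
    obtain m :: nat where m: "e [^] m \<lless> a \<or> e [^] m = a" "a \<lless> e [^] m \<otimes> e"
      using between_consecutive_powers[OF e a] .
    obtain n :: nat where n: "e [^] n \<lless> b \<or> e [^] n = b" "b \<lless> e [^] n \<otimes> e"
      using between_consecutive_powers[OF e b] .
    have low: "e [^] n \<otimes> e [^] m \<lless> b \<otimes> a \<or> e [^] n \<otimes> e [^] m = b \<otimes> a"
      using m(1) n(1) mult_strict_mono mult_left_mono mult_right_mono e a b
      by (metis nat_pow_closed)
    have eq: "(e [^] m \<otimes> e) \<otimes> (e [^] n \<otimes> e) = (e \<otimes> e) \<otimes> (e [^] n \<otimes> e [^] m)"
    proof -
      have "e \<otimes> e = e [^] (2::nat)" using e by (simp add: numeral_2_eq_2)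
      moreover have "e [^] Suc m \<otimes> e [^] Suc n = e [^] (2::nat) \<otimes> (e [^] n \<otimes> e [^] m)"
        unfolding nat_pow_mult[OF e(2)] by (rule arg_cong[where f = "\<lambda>k. e [^] k"]) simp
      ultimately show ?thesis by simp
    qed
    have "a \<otimes> b \<lless> (e [^] m \<otimes> e) \<otimes> (e [^] n \<otimes> e)"
      using mult_strict_mono[OF m(2) n(2)] a b e by simp
    then have "c \<otimes> (b \<otimes> a) \<lless> (e \<otimes> e) \<otimes> (e [^] n \<otimes> e [^] m)"
      using eq cba by simp
    then have "c \<otimes> (b \<otimes> a) \<lless> (e \<otimes> e) \<otimes> (b \<otimes> a)"
      using low mult_left_mono[of "e [^] n \<otimes> e [^] m" "b \<otimes> a" "e \<otimes> e"]
        trans[of "c \<otimes> (b \<otimes> a)" "(e \<otimes> e) \<otimes> (e [^] n \<otimes> e [^] m)"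
          "(e \<otimes> e) \<otimes> (b \<otimes> a)"] a b c e by auto
    then have "c \<lless> e \<otimes> e"
      using less_mult_right_cancel[of c "b \<otimes> a" "e \<otimes> e"] a b c e by simp
    with ec show False by blast
  qed
qed

lemma positive_commute:
  assumes "\<one> \<lless> a" "a \<in> carrier G" "\<one> \<lless> b" "b \<in> carrier G"
  shows "a \<otimes> b = b \<otimes> a"
  using total[of "a \<otimes> b" "b \<otimes> a"] positive_commutator_not_positive assms by auto

lemma positive_or_inv_positive:
  assumes "x \<in> carrier G" "x \<noteq> \<one>"
  shows "\<one> \<lless> x \<or> \<one> \<lless> inv x"
  using total[of x \<one>] mult_left_mono[of x \<one> "inv x"] assms by auto

lemma commute_inv_cancel:
  assumes "inv x \<otimes> y = y \<otimes> inv x" "x \<in> carrier G" "y \<in> carrier G"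
  shows "x \<otimes> y = y \<otimes> x"
proof -
  have "x \<otimes> y = x \<otimes> (y \<otimes> inv x) \<otimes> x"
    using assms(2,3) by (simp add: m_assoc)
  also have "\<dots> = x \<otimes> (inv x \<otimes> y) \<otimes> x"
    using assms(1) by simp
  also have "\<dots> = y \<otimes> x"
    using assms(2,3) by (simp add: m_assoc[symmetric])
  finally show ?thesis .
qed

theorem Hoelder: "comm_group G"
proof (rule group_comm_groupI)
  have pos: "x \<otimes> y = y \<otimes> x" if "x \<in> carrier G" "\<one> \<lless> y" "y \<in> carrier G" for x y
    using positive_or_inv_positive[of x] positive_commute[of x y]
      positive_commute[of "inv x" y] commute_inv_cancel[of x y] that
    by (cases "x = \<one>") auto
  fix x y assume xy: "x \<in> carrier G" "y \<in> carrier G"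
  show "x \<otimes> y = y \<otimes> x"
    using positive_or_inv_positive[of y] pos[of x y] pos[of x "inv y"]
      commute_inv_cancel[of y x] xy
    by (cases "y = \<one>") auto
qed

end

section \<open>The order on a group of homeomorphisms at infinity\<close>

lemma Homeo_plusD:
  assumes "f \<in> carrier Homeo_plus"
  shows "strict_mono f" "continuous_on A f" "surj f"
  using assms continuous_on_subset[of UNIV f A]
  by (auto simp: Homeo_plus_def homeomorphism_def)

text \<open>The limit of a bounded increasing orbit would be a fixed point.\<close>

lemma funpow_unbounded:
  fixes f :: "real \<Rightarrow> real"
  assumes cont: "continuous_on UNIV f" and right: "\<And>y. y \<ge> x \<Longrightarrow> y < f y"
  shows "\<exists>n. M < (f ^^ n) x"
proof (rule ccontr)
  assume "\<not> (\<exists>n. M < (f ^^ n) x)"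
  then have bound: "(f ^^ n) x \<le> M" for n by (simp add: not_less)
  have ge: "x \<le> (f ^^ n) x" for n
  proof (induction n)
    case (Suc n)
    then show ?case using right[OF Suc] by simp
  qed simp
  have "incseq (\<lambda>n. (f ^^ n) x)"
    using right[OF ge] by (intro incseq_SucI) (simp add: less_imp_le)
  then obtain L where L: "(\<lambda>n. (f ^^ n) x) \<longlonglongrightarrow> L" "\<And>n. (f ^^ n) x \<le> L"
    using incseq_convergent[of "\<lambda>n. (f ^^ n) x" M] bound by auto
  have "isCont f L" using cont continuous_on_eq_continuous_at[of UNIV f] by simp
  then have "(\<lambda>n. f ((f ^^ n) x)) \<longlonglongrightarrow> f L" using L(1) by (rule isCont_tendsto_compose)
  then have "(\<lambda>n. (f ^^ Suc n) x) \<longlonglongrightarrow> f L" by simp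
  then have "f L = L" using LIMSEQ_Suc[OF L(1)] LIMSEQ_unique by blast
  moreover have "x \<le> L" using L(2)[of 0] by simp
  ultimately show False using right[of L] by simp
qed

lemma nat_pow_Homeo_plus: "f [^]\<^bsub>Homeo_plus\<lparr>carrier := G\<rparr>\<^esub> (n::nat) = f ^^ n"
  by (induction n) (simp_all add: nat_pow_def Homeo_plus_def funpow_Suc_right del: funpow.simps(2))

locale fixed_points_bounded_above =
  fixes G :: "(real \<Rightarrow> real) set" and d :: real
  assumes subgroup: "subgroup G Homeo_plus"
    and fixed_le: "\<lbrakk>g \<in> G; g \<noteq> id; g x = x\<rbrakk> \<Longrightarrow> x \<le> d"
begin

lemma in_Homeo_plus: "g \<in> G \<Longrightarrow> g \<in> carrier Homeo_plus"
  using subgroup.subset[OF subgroup] by blast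

lemma eq_if_meet:
  assumes f: "f \<in> G" and g: "g \<in> G" and "d < x" "f x = g x"
  shows "f = g"
proof -
  interpret H: group Homeo_plus by (rule group_Homeo_plus)
  define h where "h = inv\<^bsub>Homeo_plus\<^esub> g"
  have h: "h \<in> G" unfolding h_def using subgroup.m_inv_closed[OF subgroup g] .
  have hg: "h \<circ> g = id" and gh: "g \<circ> h = id"
    using H.l_inv[OF in_Homeo_plus[OF g]] H.r_inv[OF in_Homeo_plus[OF g]]
    unfolding h_def by (auto simp: Homeo_plus_def)
  have "h \<circ> f \<in> G"
    using subgroup.m_closed[OF subgroup h f] by (simp add: Homeo_plus_def)
  moreover have "(h \<circ> f) x = x"
    using assms(4) hg by (metis comp_apply id_apply)
  ultimately have "h \<circ> f = id" using fixed_le \<open>d < x\<close> by fastforce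
  then have "g \<circ> h \<circ> f = g" by (simp add: comp_assoc)
  then show ?thesis using gh by simp
qed

definition less_at_infinity :: "(real \<Rightarrow> real) \<Rightarrow> (real \<Rightarrow> real) \<Rightarrow> bool" where
  "less_at_infinity f g \<longleftrightarrow> (\<forall>x>d. f x < g x)"

text \<open>If the inequality were reversed at another point, then the two graphs would meet in between.\<close>

lemma less_if_less_at_point:
  assumes f: "f \<in> G" and g: "g \<in> G" and x: "d < x" "f x < g x"
  shows "less_at_infinity f g"
  unfolding less_at_infinity_def
proof (intro allI impI, rule ccontr)
  fix y assume y: "d < y" "\<not> f y < g y"
  define u where "u z = g z - f z" for z
  have "continuous_on A u" for A
    unfolding u_def
    using Homeo_plusD(2)[OF in_Homeo_plus[OF f]] Homeo_plusD(2)[OF in_Homeo_plus[OF g]]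
    by (intro continuous_intros)
  moreover have "0 \<in> closed_segment (u x) (u y)"
    using x(2) y(2) by (auto simp: u_def closed_segment_eq_real_ivl)
  ultimately obtain z where z: "z \<in> closed_segment x y" "u z = 0"
    using IVT'_closed_segment_real by metis
  moreover have "d < z"
    using z(1) x(1) y(1) by (auto simp: closed_segment_eq_real_ivl split: if_splits)
  ultimately have "f = g" using eq_if_meet[OF f g, of z] by (simp add: u_def)
  then show False using x by simp
qed

theorem archimedean_ordered:
  "archimedean_ordered_group (Homeo_plus\<lparr>carrier := G\<rparr>) less_at_infinity"
proof -
  interpret K: group "Homeo_plus\<lparr>carrier := G\<rparr>"
    using subgroup.subgroup_is_group[OF subgroup group_Homeo_plus] .
  have mult: "f \<otimes>\<^bsub>Homeo_plus\<lparr>carrier := G\<rparr>\<^esub> g = f \<circ> g" for f g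
    by (simp add: Homeo_plus_def)
  have one: "\<one>\<^bsub>Homeo_plus\<lparr>carrier := G\<rparr>\<^esub> = id"
    by (simp add: Homeo_plus_def)
  have comp: "f \<circ> g \<in> G" if "f \<in> G" "g \<in> G" for f g
    using subgroup.m_closed[OF subgroup that] by (simp add: Homeo_plus_def)
  have carrier: "carrier (Homeo_plus\<lparr>carrier := G\<rparr>) = G" by simp
  show ?thesis
  proof (unfold_locales, unfold mult one nat_pow_Homeo_plus carrier)
    show "\<not> less_at_infinity f f" if "f \<in> G" for f
      unfolding less_at_infinity_def using gt_ex[of d] by blast
  next
    show "less_at_infinity f h" if "less_at_infinity f g" "less_at_infinity g h" for f g h
      using that unfolding less_at_infinity_def by fastforce
  next
    fix f g assume fg: "f \<in> G" "g \<in> G" "f \<noteq> g"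
    have "f (d + 1) \<noteq> g (d + 1)" using eq_if_meet[OF fg(1,2), of "d + 1"] fg(3) by auto
    then consider "f (d + 1) < g (d + 1)" | "g (d + 1) < f (d + 1)" by linarith
    then show "less_at_infinity f g \<or> less_at_infinity g f"
      using less_if_less_at_point[of _ _ "d + 1"] fg(1,2) by cases auto
  next
    fix f g h assume less: "less_at_infinity f g" and "h \<in> G"
    then show "less_at_infinity (h \<circ> f) (h \<circ> g)"
      using Homeo_plusD(1)[OF in_Homeo_plus] unfolding less_at_infinity_def
      by (simp add: strict_monoD)
  next
    fix f g h assume less: "less_at_infinity f g" and G: "f \<in> G" "g \<in> G" "h \<in> G"
    have h: "strict_mono h" "surj h" using Homeo_plusD in_Homeo_plus[OF G(3)] by auto
    (* h need not map (d, \<infinity>) into itself, but some point beyond d has its image beyond d. *)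
    obtain y where y: "h y = d + 1" using h(2) by (metis surjD)
    define x where "x = max y (d + 1)"
    have "h y \<le> h x" using h(1) by (simp add: x_def strict_mono_less_eq)
    then have "d < h x" "d < x" using y by (auto simp: x_def)
    then show "less_at_infinity (f \<circ> h) (g \<circ> h)"
      using less_if_less_at_point[OF comp comp, of f h g h x] G less
      by (auto simp: less_at_infinity_def)
  next
    fix f g assume less: "less_at_infinity id f" and G: "f \<in> G" "g \<in> G"
    have "continuous_on UNIV f" using Homeo_plusD(2) in_Homeo_plus[OF G(1)] by auto
    moreover have "y < f y" if "y \<ge> d + 1" for y
      using less that by (simp add: less_at_infinity_def)
    ultimately obtain n where n: "g (d + 1) < (f ^^ n) (d + 1)"
      using funpow_unbounded by blast
    have "f ^^ n \<in> G"
      using K.nat_pow_closed[of f n] G by (simp add: nat_pow_Homeo_plus)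
    then show "\<exists>n. less_at_infinity g (f ^^ n)"
      using less_if_less_at_point[of g "f ^^ n" "d + 1"] G n by auto
  qed
qed

end

theorem theorem1p1:
  fixes G :: "(real \<Rightarrow> real) set"
  assumes "subgroup G Homeo_plus"
    and "\<exists>c d :: real. c \<le> d \<and> (\<forall>g\<in>G. g \<noteq> \<one>\<^bsub>Homeo_plus\<^esub> \<longrightarrow> Fix g \<subseteq> {c..d})"
  shows "comm_group (Homeo_plus\<lparr>carrier := G\<rparr>)"
proof -
  obtain c d :: real where d: "\<forall>g\<in>G. g \<noteq> \<one>\<^bsub>Homeo_plus\<^esub> \<longrightarrow> Fix g \<subseteq> {c..d}"
    using assms(2) by blast
  have "fixed_points_bounded_above G d"
  proof (rule fixed_points_bounded_above.intro)
    show "subgroup G Homeo_plus" by (fact assms(1))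
    show "x \<le> d" if "g \<in> G" "g \<noteq> id" "g x = x" for g x
      using d that by (fastforce simp: Fix_def Homeo_plus_def)
  qed
  then show ?thesis
    by (rule archimedean_ordered_group.Hoelder[OF fixed_points_bounded_above.archimedean_ordered])
qed

end
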